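(* Let $e(X)$, $e^*(X)$, $\mu_1(X)$, $\mu^*_1(X)$ be, respectively, the true propensity score, the limiting misspecified propensity score, the true conditional mean of $Y(1)$ and the limiting misspecified outcome regression for $Y(1)$, as described in the context, and let $\mu_1=E[Y(1)]$, $\mu_1^*=E[\mu_1^*(X)]$. Suppose that at least one of the following holds: (a) $\mu_1^*=\mu_1$ and $$0<E\left[\frac{e(X)}{e^*(X)}-1\right]\mu_1<\operatorname{cov}\left[\frac{e(X)}{e^*(X)},\mu_1^*(X)\right]<\operatorname{cov}\left[\frac{e(X)}{e^*(X)},\mu_1(X)\right];$$ (b) $$\left|E\left[\left(\frac{e(X)}{e^*(X)}-1\right)\mu^*_1(X)\right]\right|<2\cdot\left|E\left[\left(\frac{e(X)}{e^*(X)}-1\right)\mu_1(X)\right]\right|,$$ and $E\left[\left(\frac{e(X)}{e^*(X)}-1\right)\mu^*_1(X)\right]$ and $E\left[\left(\frac{e(X)}{e^*(X)}-1\right)\mu_1(X)\right]$ are either both positive or both negative. Then $$\left|E\left[\left(\frac{e(X)}{e^*(X)}-1\right)\left(\mu_1(X)-\mu^*_1(X)\right)\right]\right|<\left|E\left[\left(\frac{e(X)}{e^*(X)}-1\right)\mu_1(X)\right]\right|.$$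
   Context: $X$ is a random vector of covariates, $T\in\{0,1\}$ a binary treatment, $Y(1)$ an integrable real-valued potential outcome with $Y(1)$ conditionally independent of $T$ given $X$. $e(X)=P(T=1\mid X)$, with $\eta<e(X)<1-\eta$ a.s. for some $\eta>0$; $e^*(X)$ is a measurable function of $X$ (the probability limit of a possibly misspecified propensity score model) with $\nu<e^*(X)<1-\nu$ a.s. for some $\nu>0$. $\mu_1(X)=E(Y(1)\mid X)$; $\mu^*_1(X)$ is an integrable function of $X$ (the probability limit of a possibly misspecified outcome regression model). $\operatorname{cov}[A,B]=E[AB]-E[A]E[B]$. The quantity $E[(\frac{e(X)}{e^*(X)}-1)(\mu_1(X)-\mu_1^*(X))]$ is the part of the asymptotic bias of the doubly robust estimator concerning $\mu_1$, and $E[(\frac{e(X)}{e^*(X)}-1)\mu_1(X)]=E[\frac{e(X)}{e^*(X)}\mu_1(X)]-\mu_1$ is the corresponding part for the simple inverse probability weighting estimator. *)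

theory Defs
  imports "HOL-Probability.Probability"
begin

definition gen_alg :: "'a measure \<Rightarrow> 'b measure \<Rightarrow> ('a \<Rightarrow> 'b) \<Rightarrow> 'a measure" where
  "gen_alg M N X = vimage_algebra (space M) X N"

text \<open>The conditional probability of an event given a sub-sigma-algebra \<open>F\<close>, as opposed to
  \<open>cond_prob\<close>, which conditions on an event. Like \<open>real_cond_exp\<close>, it is meaningful only up to
  null sets.\<close>

definition cond_prob_alg :: "'a measure \<Rightarrow> 'a measure \<Rightarrow> ('a \<Rightarrow> bool) \<Rightarrow> 'a \<Rightarrow> real" where
  "cond_prob_alg M F P = real_cond_exp M F (indicator {\<omega> \<in> space M. P \<omega>})"

definition cond_indep_var ::
  "'a measure \<Rightarrow> 'a measure \<Rightarrow> 'b measure \<Rightarrow> ('a \<Rightarrow> 'b) \<Rightarrow> 'c measure \<Rightarrow> ('a \<Rightarrow> 'c) \<Rightarrow> bool" where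
  "cond_indep_var M F N1 U N2 V \<longleftrightarrow>
     subalgebra M F \<and> U \<in> measurable M N1 \<and> V \<in> measurable M N2 \<and>
     (\<forall>A \<in> sets N1. \<forall>B \<in> sets N2. AE \<omega> in M.
        cond_prob_alg M F (\<lambda>\<omega>. U \<omega> \<in> A \<and> V \<omega> \<in> B) \<omega> =
        cond_prob_alg M F (\<lambda>\<omega>. U \<omega> \<in> A) \<omega> * cond_prob_alg M F (\<lambda>\<omega>. V \<omega> \<in> B) \<omega>)"

definition covariance :: "'a measure \<Rightarrow> ('a \<Rightarrow> real) \<Rightarrow> ('a \<Rightarrow> real) \<Rightarrow> real" where
  "covariance M U V =
     prob_space.expectation M (\<lambda>\<omega>. U \<omega> * V \<omega>)
       - prob_space.expectation M U * prob_space.expectation M V"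

end

theory Submission
  imports Defs
begin

text \<open>With \<open>c = E[e/e\<^sup>* - 1] \<mu>\<^sub>1\<close>, the bias integrals satisfy
  \<open>E[(e/e\<^sup>* - 1) f] = cov[e/e\<^sup>*, f] + c\<close> for both \<open>f = \<mu>\<^sub>1(X)\<close> and \<open>f = \<mu>\<^sub>1\<^sup>*(X)\<close> under (a),
  because the two have the same mean. Hence (a) gives \<open>0 < B < A\<close>, where \<open>A\<close> and \<open>B\<close> are the
  bias integrals of \<open>\<mu>\<^sub>1(X)\<close> and \<open>\<mu>\<^sub>1\<^sup>*(X)\<close>, a special case of (b); and (b) says that
  \<open>B / A\<close> lies in \<open>(0, 2)\<close>, which is \<open>\<bar>A - B\<bar> < \<bar>A\<bar>\<close>.\<close>

text \<open>Domination by \<open>C * f\<close>. Needed because \<open>mu1\<close> and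
  \<open>mu1star\<close> are only known to be integrable along \<open>X\<close>, so their products
  with the weight \<open>e / estar\<close> require the weight to be bounded.\<close>

lemma integrable_AE_bounded_mult:
  fixes W f :: "'a \<Rightarrow> real"
  assumes "W \<in> borel_measurable M" and "AE x in M. \<bar>W x\<bar> \<le> C" and f: "integrable M f"
  shows "integrable M (\<lambda>x. W x * f x)"
proof (rule Bochner_Integration.integrable_bound)
  show "integrable M (\<lambda>x. C * f x)" using f by simp
  show "(\<lambda>x. W x * f x) \<in> borel_measurable M" using assms by measurable
  show "AE x in M. norm (W x * f x) \<le> norm (C * f x)"
    using assms(2) by eventually_elim (auto simp: abs_mult intro!: mult_right_mono)
qed

text \<open>Expanding both sides leaves \<open>E[W f] - E[f]\<close>: the terms
  \<open>E[W] E[f]\<close> cancel, and total mass one turns \<open>E[W - 1]\<close> into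
  \<open>E[W] - 1\<close>.\<close>

lemma (in prob_space) expectation_diff_one_mult:
  fixes W f :: "'a \<Rightarrow> real"
  assumes "integrable M W" "integrable M f" "integrable M (\<lambda>\<omega>. W \<omega> * f \<omega>)"
  shows "expectation (\<lambda>\<omega>. (W \<omega> - 1) * f \<omega>)
    = covariance M W f + expectation (\<lambda>\<omega>. W \<omega> - 1) * expectation f"
  using assms by (simp add: covariance_def left_diff_distrib prob_space)

theorem theorem12:
  fixes M :: "'a measure"
    and X :: "'a \<Rightarrow> real ^ 'd"
    and T :: "'a \<Rightarrow> nat"
    and Y1 :: "'a \<Rightarrow> real"
    and e estar mu1 mu1star :: "real ^ 'd \<Rightarrow> real"
  assumes "prob_space M"
    and "X \<in> borel_measurable M"
    and "T \<in> measurable M (count_space {0, 1})"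
    and "integrable M Y1"
    and "cond_indep_var M (gen_alg M borel X) borel Y1 (count_space {0, 1}) T"
    and "e \<in> borel_measurable borel"
    and "AE \<omega> in M. e (X \<omega>) = cond_prob_alg M (gen_alg M borel X) (\<lambda>\<omega>. T \<omega> = 1) \<omega>"
    and "\<exists>\<eta>>0. AE \<omega> in M. \<eta> < e (X \<omega>) \<and> e (X \<omega>) < 1 - \<eta>"
    and "estar \<in> borel_measurable borel"
    and "\<exists>\<nu>>0. AE \<omega> in M. \<nu> < estar (X \<omega>) \<and> estar (X \<omega>) < 1 - \<nu>"
    and "mu1 \<in> borel_measurable borel"
    and "AE \<omega> in M. mu1 (X \<omega>) = real_cond_exp M (gen_alg M borel X) Y1 \<omega>"
    and "mu1star \<in> borel_measurable borel"
    and "integrable M (\<lambda>\<omega>. mu1star (X \<omega>))"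
    and "(prob_space.expectation M (\<lambda>\<omega>. mu1star (X \<omega>)) = prob_space.expectation M Y1 \<and>
          0 < prob_space.expectation M (\<lambda>\<omega>. e (X \<omega>) / estar (X \<omega>) - 1)
                * prob_space.expectation M Y1 \<and>
          prob_space.expectation M (\<lambda>\<omega>. e (X \<omega>) / estar (X \<omega>) - 1)
                * prob_space.expectation M Y1
            < covariance M (\<lambda>\<omega>. e (X \<omega>) / estar (X \<omega>)) (\<lambda>\<omega>. mu1star (X \<omega>)) \<and>
          covariance M (\<lambda>\<omega>. e (X \<omega>) / estar (X \<omega>)) (\<lambda>\<omega>. mu1star (X \<omega>))
            < covariance M (\<lambda>\<omega>. e (X \<omega>) / estar (X \<omega>)) (\<lambda>\<omega>. mu1 (X \<omega>)))
       \<or>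
         (\<bar>prob_space.expectation M (\<lambda>\<omega>. (e (X \<omega>) / estar (X \<omega>) - 1) * mu1star (X \<omega>))\<bar>
            < 2 * \<bar>prob_space.expectation M (\<lambda>\<omega>. (e (X \<omega>) / estar (X \<omega>) - 1) * mu1 (X \<omega>))\<bar> \<and>
          (0 < prob_space.expectation M (\<lambda>\<omega>. (e (X \<omega>) / estar (X \<omega>) - 1) * mu1star (X \<omega>)) \<and>
           0 < prob_space.expectation M (\<lambda>\<omega>. (e (X \<omega>) / estar (X \<omega>) - 1) * mu1 (X \<omega>))
          \<or>
           prob_space.expectation M (\<lambda>\<omega>. (e (X \<omega>) / estar (X \<omega>) - 1) * mu1star (X \<omega>)) < 0 \<and>
           prob_space.expectation M (\<lambda>\<omega>. (e (X \<omega>) / estar (X \<omega>) - 1) * mu1 (X \<omega>)) < 0))"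
  shows "\<bar>prob_space.expectation M
            (\<lambda>\<omega>. (e (X \<omega>) / estar (X \<omega>) - 1) * (mu1 (X \<omega>) - mu1star (X \<omega>)))\<bar>
       < \<bar>prob_space.expectation M (\<lambda>\<omega>. (e (X \<omega>) / estar (X \<omega>) - 1) * mu1 (X \<omega>))\<bar>"
proof -
  interpret prob_space M by fact
  have [measurable]: "X \<in> borel_measurable M" "e \<in> borel_measurable borel"
      "estar \<in> borel_measurable borel"
    using assms by auto
  define W where "W = (\<lambda>\<omega>. e (X \<omega>) / estar (X \<omega>))"
  have [measurable]: "W \<in> borel_measurable M" unfolding W_def by measurable
  obtain \<nu> where "\<nu> > 0" and star: "AE \<omega> in M. \<nu> < estar (X \<omega>) \<and> estar (X \<omega>) < 1 - \<nu>"
    using assms(10) by blast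
  obtain \<eta> where "\<eta> > 0" and e: "AE \<omega> in M. \<eta> < e (X \<omega>) \<and> e (X \<omega>) < 1 - \<eta>"
    using assms(8) by blast
  \<comment> \<open>Overlap makes numerator and denominator positive, with
    \<open>e (X \<omega>) < 1\<close> and \<open>estar (X \<omega>) > \<nu>\<close>.\<close>
  have W_bound: "AE \<omega> in M. \<bar>W \<omega>\<bar> \<le> 1 / \<nu>"
    using star e
  proof eventually_elim
    case (elim \<omega>)
    then show ?case
      using \<open>\<nu> > 0\<close> \<open>\<eta> > 0\<close> by (auto simp: W_def intro!: frac_le)
  qed
  have W_mult: "integrable M (\<lambda>\<omega>. W \<omega> * f \<omega>)" if "integrable M f" for f :: "'a \<Rightarrow> real"
    using W_bound that by (rule integrable_AE_bounded_mult[rotated]) simp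
  have W_int: "integrable M W" using W_mult[of "\<lambda>_. 1"] by simp

  \<comment> \<open>Conditional independence carries the subalgebra property by definition; this
    gives access to the facts on \<open>real_cond_exp\<close>.\<close>
  have "subalgebra M (gen_alg M borel X)" using assms(5) by (simp add: cond_indep_var_def)
  then interpret finite_measure_subalgebra M "gen_alg M borel X" by unfold_locales
  have [measurable]: "(\<lambda>\<omega>. mu1 (X \<omega>)) \<in> borel_measurable M"
    "real_cond_exp M (gen_alg M borel X) Y1 \<in> borel_measurable M"
    using assms(11) by auto
  \<comment> \<open>Integrability and mean pass from \<open>Y1\<close> to its conditional
    expectation (tower property), then to \<open>mu1 (X \<omega>)\<close> by a.e. equality.\<close>
  have mu1_int: "integrable M (\<lambda>\<omega>. mu1 (X \<omega>))"
    using integrable_cong_AE[OF _ _ assms(12)] real_cond_exp_int(1)[OF assms(4)] by simp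
  have mu1_mean: "expectation (\<lambda>\<omega>. mu1 (X \<omega>)) = expectation Y1"
    using integral_cong_AE[OF _ _ assms(12)] real_cond_exp_int(2)[OF assms(4)] by simp

  note star_int = \<open>integrable M (\<lambda>\<omega>. mu1star (X \<omega>))\<close>
  define A where "A = expectation (\<lambda>\<omega>. (W \<omega> - 1) * mu1 (X \<omega>))"
  define B where "B = expectation (\<lambda>\<omega>. (W \<omega> - 1) * mu1star (X \<omega>))"
  define c where "c = expectation (\<lambda>\<omega>. W \<omega> - 1)"
  have A: "A = covariance M W (\<lambda>\<omega>. mu1 (X \<omega>)) + c * expectation Y1"
    unfolding A_def c_def mu1_mean[symmetric]
    by (intro expectation_diff_one_mult W_int mu1_int W_mult)
  have B: "B = covariance M W (\<lambda>\<omega>. mu1star (X \<omega>)) + c * expectation (\<lambda>\<omega>. mu1star (X \<omega>))"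
    unfolding B_def c_def by (intro expectation_diff_one_mult W_int star_int W_mult)
  \<comment> \<open>Linearity of the integral applies because each of the four products in the
    expansion is integrable.\<close>
  have "expectation (\<lambda>\<omega>. (W \<omega> - 1) * (mu1 (X \<omega>) - mu1star (X \<omega>))) = A - B"
    using W_mult[OF mu1_int] W_mult[OF star_int] mu1_int star_int
    by (simp add: A_def B_def algebra_simps)
  moreover have "\<bar>B\<bar> < 2 * \<bar>A\<bar> \<and> (0 < B \<and> 0 < A \<or> B < 0 \<and> A < 0)"
    using assms(15)
  proof
    assume "expectation (\<lambda>\<omega>. mu1star (X \<omega>)) = expectation Y1 \<and>
          0 < expectation (\<lambda>\<omega>. e (X \<omega>) / estar (X \<omega>) - 1) * expectation Y1 \<and>
          expectation (\<lambda>\<omega>. e (X \<omega>) / estar (X \<omega>) - 1) * expectation Y1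
            < covariance M (\<lambda>\<omega>. e (X \<omega>) / estar (X \<omega>)) (\<lambda>\<omega>. mu1star (X \<omega>)) \<and>
          covariance M (\<lambda>\<omega>. e (X \<omega>) / estar (X \<omega>)) (\<lambda>\<omega>. mu1star (X \<omega>))
            < covariance M (\<lambda>\<omega>. e (X \<omega>) / estar (X \<omega>)) (\<lambda>\<omega>. mu1 (X \<omega>))"
    \<comment> \<open>Equal means give \<open>A\<close> and \<open>B\<close> the same shift
      \<open>c * expectation Y1\<close>, so they are ordered as the covariances; \<open>B\<close> is
      a sum of two positive terms.\<close>
    then have "0 < B \<and> B < A" by (simp add: A B flip: W_def c_def[unfolded W_def])
    then show ?thesis by linarith
  qed (simp add: A_def B_def W_def)
  ultimately have "\<bar>expectation (\<lambda>\<omega>. (W \<omega> - 1) * (mu1 (X \<omega>) - mu1star (X \<omega>)))\<bar> < \<bar>A\<bar>"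
    by linarith
  then show ?thesis by (simp add: A_def W_def)
qed

end
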